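(* Let $\Gamma$ be a numerical semigroup with multiplicity $m$, concentration $\mathbf{C}(\Gamma)=k\geq 2$, with $e_s\geq k+1$, delta-invariant $\delta(\Gamma)\geq m-k$, and conductor $c>2m$. Then $E(\Gamma)\geq 0$. In particular, any highly dense numerical semigroup $\Gamma$ with $e_s\geq k+1$ and $\delta(\Gamma)\geq m-k$, where $k=\mathbf{C}(\Gamma)$ and $m$ is the multiplicity of $\Gamma$, has nonnegative Eliahou number $E(\Gamma)\geq 0$.
   Context: $\mathbb{N}$ denotes the set of nonnegative integers. A numerical semigroup $\Gamma$ is an additive submonoid of $(\mathbb{N},+)$ whose elements have greatest common divisor $1$, so that $\mathbb{N}\setminus\Gamma$ is finite; it is assumed that $\Gamma\neq\mathbb{N}$. The multiplicity is $m=m(\Gamma)=\min(\Gamma\setminus\{0\})$, the conductor is $c=c(\Gamma)=\max(\mathbb{N}\setminus\Gamma)+1$, and the delta-invariant $\delta(\Gamma)$ is the number of elements of $\Gamma$ (including $0$) that are smaller than $c$. $G$ denotes the (finite, unique) minimal system of generators of $\Gamma$, and $e(\Gamma)=|G|$ is the embedding dimension. The concentration of $\Gamma$ is $\mathbf{C}(\Gamma)=\max\{\operatorname{next}_\Gamma(s)-s : s\in\Gamma\setminus\{0\}\}$, where $\operatorname{next}_\Gamma(s)=\min\{x\in\Gamma : s<x\}$. $\Gamma$ is called highly dense if one of the following two conditions is satisfied: (1) $\mathbf{C}(\Gamma)\leq 2$; (2) $\mathbf{C}(\Gamma)\leq e(\Gamma)/2$ and $4\leq e(\Gamma)$. Eliahou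 number: put $q=\lceil c/m\rceil$, $\nu=qm-c$, $J_q=\{c,c+1,\ldots,c+m-1\}$, $p_q=J_q\cap G$, $d_q=J_q\setminus p_q$, and $e_s=|\{g\in G : g<c\}|$. Then $E(\Gamma)=e_s\,\delta(\Gamma)-q\,|d_q|+\nu$. *)

theory Defs
  imports Complex_Main
begin

definition add_submonoid :: "nat set \<Rightarrow> bool" where
  "add_submonoid S \<longleftrightarrow> 0 \<in> S \<and> (\<forall>x\<in>S. \<forall>y\<in>S. x + y \<in> S)"

(* The semigroup of all natural numbers is not excluded here; the theorem assumes G \<noteq> UNIV. *)
definition numerical_semigroup :: "nat set \<Rightarrow> bool" where
  "numerical_semigroup G \<longleftrightarrow> add_submonoid G \<and> Gcd G = 1"

definition multiplicity :: "nat set \<Rightarrow> nat" where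
  "multiplicity G = (LEAST x. x \<in> G - {0})"

definition conductor :: "nat set \<Rightarrow> nat" where
  "conductor G = Max (UNIV - G) + 1"

definition delta :: "nat set \<Rightarrow> nat" where
  "delta G = card {x \<in> G. x < conductor G}"

definition minimal_generating_set :: "nat set \<Rightarrow> nat set \<Rightarrow> bool" where
  "minimal_generating_set A G \<longleftrightarrow>
     add_submonoid hull A = G \<and> (\<forall>B. B \<subset> A \<longrightarrow> add_submonoid hull B \<noteq> G)"

definition min_gens :: "nat set \<Rightarrow> nat set" where
  "min_gens G = (THE A. minimal_generating_set A G)"

(* The description in min_gens is proper: the minimal generating set exists and is unique. *)
lemma minimal_generating_set_ex1:
  assumes G: "add_submonoid G"
  shows "\<exists>!A. minimal_generating_set A G"
proof -
  define T where "T = {x \<in> G. x \<noteq> 0 \<and> (\<forall>a\<in>G. \<forall>b\<in>G. a + b = x \<longrightarrow> a = 0 \<or> b = 0)}"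
  have sub: "add_submonoid (add_submonoid hull A)" for A
    by (rule hull_in) (auto simp: add_submonoid_def)
  have TG: "add_submonoid hull T \<subseteq> G"
    by (rule hull_minimal) (use G in \<open>auto simp: T_def\<close>)
  have "x \<in> G \<longrightarrow> x \<in> add_submonoid hull T" for x
  proof (induction x rule: less_induct)
    case (less x)
    show ?case
    proof
      assume x: "x \<in> G"
      show "x \<in> add_submonoid hull T"
      proof (cases "x = 0 \<or> x \<in> T")
        case True
        then show ?thesis
          using sub[of T] hull_inc[of x T add_submonoid] by (auto simp: add_submonoid_def)
      next
        case False
        then obtain a b where ab: "a \<in> G" "b \<in> G" "a + b = x" "a \<noteq> 0" "b \<noteq> 0"
          using x by (auto simp: T_def)
        then have "a \<in> add_submonoid hull T" "b \<in> add_submonoid hull T"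
          using less.IH[of a] less.IH[of b] by auto
        then show ?thesis
          using sub[of T] ab(3) unfolding add_submonoid_def by blast
      qed
    qed
  qed
  then have gen: "add_submonoid hull T = G"
    using TG by blast
  have least: "T \<subseteq> A" if A: "add_submonoid hull A = G" for A
  proof
    fix x assume x: "x \<in> T"
    show "x \<in> A"
    proof (rule ccontr)
      assume "x \<notin> A"
      moreover have "A \<subseteq> G"
        using hull_subset[of A add_submonoid] A by simp
      ultimately have "A \<subseteq> G - {x}" by blast
      moreover have "add_submonoid (G - {x})"
        unfolding add_submonoid_def
      proof (intro conjI ballI)
        show "0 \<in> G - {x}" using G x by (auto simp: add_submonoid_def T_def)
        fix a b assume a: "a \<in> G - {x}" and b: "b \<in> G - {x}"
        then have "a + b \<in> G" using G by (auto simp: add_submonoid_def)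
        moreover have "a + b \<noteq> x"
        proof
          assume e: "a + b = x"
          then have "a = 0 \<or> b = 0" using x a b unfolding T_def by blast
          then show False using e a b by auto
        qed
        ultimately show "a + b \<in> G - {x}" by simp
      qed
      ultimately have "add_submonoid hull A \<subseteq> G - {x}"
        by (rule hull_minimal)
      then show False using A x by (auto simp: T_def)
    qed
  qed
  show ?thesis
  proof (rule ex1I[of _ T])
    show "minimal_generating_set T G"
      unfolding minimal_generating_set_def using gen least by blast
  next
    fix A assume "minimal_generating_set A G"
    then show "A = T"
      unfolding minimal_generating_set_def using gen least by blast
  qed
qed

definition embedding_dim :: "nat set \<Rightarrow> nat" where
  "embedding_dim G = card (min_gens G)"

definition next_elem :: "nat set \<Rightarrow> nat \<Rightarrow> nat" where
  "next_elem G s = (LEAST x. x \<in> G \<and> s < x)"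

definition concentration :: "nat set \<Rightarrow> nat" where
  "concentration G = Max {next_elem G s - s | s. s \<in> G - {0}}"

definition highly_dense :: "nat set \<Rightarrow> bool" where
  "highly_dense G \<longleftrightarrow>
     concentration G \<le> 2 \<or>
     (real (concentration G) \<le> real (embedding_dim G) / 2 \<and> 4 \<le> embedding_dim G)"

definition q_num :: "nat set \<Rightarrow> int" where
  "q_num G = \<lceil>real (conductor G) / real (multiplicity G)\<rceil>"

definition nu_num :: "nat set \<Rightarrow> int" where
  "nu_num G = q_num G * int (multiplicity G) - int (conductor G)"

definition J_q :: "nat set \<Rightarrow> nat set" where
  "J_q G = {conductor G ..< conductor G + multiplicity G}"

definition p_q :: "nat set \<Rightarrow> nat set" where
  "p_q G = J_q G \<inter> min_gens G"

definition d_q :: "nat set \<Rightarrow> nat set" where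
  "d_q G = J_q G - p_q G"

definition e_s :: "nat set \<Rightarrow> nat" where
  "e_s G = card {g \<in> min_gens G. g < conductor G}"

definition Eliahou :: "nat set \<Rightarrow> int" where
  "Eliahou G = int (e_s G) * int (delta G) - q_num G * int (card (d_q G)) + nu_num G"

end

theory Submission
  imports Defs
begin

text \<open>
  Write \<open>c\<close>, \<open>\<delta>\<close>, \<open>m\<close>, \<open>k\<close> for the conductor, the delta-invariant, the multiplicity and the
  concentration of \<open>\<Gamma>\<close>. Substituting \<open>\<nu> = q m - c\<close> into the Eliahou number gives
  \<open>E = e\<^sub>s \<delta> + q (m - |d\<^sub>q|) - c\<close>, and \<open>d\<^sub>q\<close> lies in an interval with \<open>m\<close> elements; hence
  \<open>E \<ge> 0\<close> as soon as \<open>e\<^sub>s \<delta> \<ge> c\<close> (\<open>Eliahou_nonneg_if_conductor_le\<close>).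

  The concentration bounds \<open>c\<close>: after \<open>m\<close> the jumps of \<open>\<Gamma>\<close> have length at most \<open>k\<close>, and only
  \<open>\<delta> - 1\<close> nonzero elements lie below \<open>c\<close>, so that \<open>c - m \<le> k (\<delta> - 1)\<close>
  (\<open>conductor_le_concentration\<close>). Adding \<open>m - k \<le> \<delta>\<close> to this inequality yields
  \<open>c \<le> (k + 1) \<delta> \<le> e\<^sub>s \<delta>\<close>. Both claims are instances of this one estimate.
\<close>

lemma multiplicity_in:
  assumes "x \<in> G" and "x \<noteq> 0"
  shows "multiplicity G \<in> G" and "multiplicity G \<noteq> 0"
  using LeastI[of "\<lambda>x. x \<in> G - {0}" x] assms
  unfolding multiplicity_def by auto

text \<open>
  The jumps of a submonoid are bounded, because translation by a nonzero element \<open>x\<close> gives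
  \<open>s + x\<close> as an element above \<open>s\<close>. The maximum in the definition of the concentration is
  therefore taken over a finite set, and it bounds every jump.
\<close>

lemma next_elem_le_concentration:
  assumes G: "add_submonoid G" and x: "x \<in> G" "x \<noteq> 0" and s: "s \<in> G" "s \<noteq> 0"
  shows "next_elem G s - s \<le> concentration G"
proof -
  have "next_elem G t \<le> t + x" if "t \<in> G" for t
    unfolding next_elem_def
    by (rule Least_le) (use G x that in \<open>auto simp: add_submonoid_def\<close>)
  then have "{next_elem G t - t | t. t \<in> G - {0}} \<subseteq> {..x}"
    by (auto simp: le_diff_conv add.commute)
  then have "finite {next_elem G t - t | t. t \<in> G - {0}}"
    by (rule finite_subset) simp
  then show ?thesis
    unfolding concentration_def using s by (intro Max_ge) auto
qed

text \<open>
  Each point of the interval from \<open>m\<close> to \<open>c\<close> is less than \<open>k\<close> above the largest element of \<open>G\<close>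
  that does not exceed it. Blocks of length \<open>k\<close> that start at the \<open>\<delta> - 1\<close> nonzero elements below
  \<open>c\<close> thus cover the interval, and the claim follows by counting.
\<close>

lemma conductor_le_concentration:
  assumes G: "add_submonoid G" and x: "x \<in> G" "x \<noteq> 0"
  shows "conductor G + concentration G \<le> multiplicity G + concentration G * delta G"
proof -
  let ?c = "conductor G" and ?k = "concentration G" and ?m = "multiplicity G"
  let ?S = "{s \<in> G. s < ?c} - {0}"
  note m = multiplicity_in[OF x]
  have "{?m..<?c} \<subseteq> (\<Union>s\<in>?S. {s..<s + ?k})"
  proof
    fix y assume y: "y \<in> {?m..<?c}"
    define s where "s = Max {s \<in> G. s \<le> y}"
    have fin: "finite {s \<in> G. s \<le> y}" by simp
    have "s \<in> {s \<in> G. s \<le> y}"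
      unfolding s_def by (rule Max_in[OF fin]) (use m(1) y in auto)
    moreover have "?m \<le> s"
      unfolding s_def by (rule Max_ge[OF fin]) (use m(1) y in auto)
    ultimately have s: "s \<in> G" "s \<le> y" "s \<noteq> 0"
      using m(2) by auto
    have "next_elem G s \<in> G \<and> s < next_elem G s"
      unfolding next_elem_def
      by (rule LeastI[of _ "s + x"]) (use G x s in \<open>auto simp: add_submonoid_def\<close>)
    moreover have "z \<le> s" if "z \<in> G" "z \<le> y" for z
      unfolding s_def by (rule Max_ge[OF fin]) (use that in auto)
    ultimately have "y < next_elem G s"
      by (meson not_less)
    with next_elem_le_concentration[OF G x s(1,3)] have "y < s + ?k"
      by linarith
    with s y show "y \<in> (\<Union>s\<in>?S. {s..<s + ?k})" by auto
  qed
  then have "card {?m..<?c} \<le> card (\<Union>s\<in>?S. {s..<s + ?k})"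
    by (intro card_mono) auto
  also have "\<dots> \<le> (\<Sum>s\<in>?S. card {s..<s + ?k})"
    by (rule card_UN_le) simp
  finally have cover: "?c - ?m \<le> card ?S * ?k"
    by simp
  have zero: "0 \<in> {s \<in> G. s < ?c}"
    using G by (auto simp: add_submonoid_def conductor_def)
  then have "delta G = Suc (card ?S)"
    unfolding delta_def by (subst card_Suc_Diff1) auto
  with cover show ?thesis by (simp add: algebra_simps)
qed

lemma Eliahou_nonneg_if_conductor_le:
  assumes "conductor G \<le> e_s G * delta G"
  shows "Eliahou G \<ge> 0"
proof -
  have "card (d_q G) \<le> card (J_q G)"
    by (rule card_mono) (auto simp: d_q_def J_q_def)
  then have d: "int (card (d_q G)) \<le> int (multiplicity G)"
    by (simp add: J_q_def)
  have "real_of_int 0 \<le> real (conductor G) / real (multiplicity G)"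
    by simp
  then have "0 \<le> q_num G"
    unfolding q_num_def by (metis ceiling_mono ceiling_of_int)
  then have "q_num G * int (card (d_q G)) \<le> q_num G * int (multiplicity G)"
    using d by (rule mult_left_mono[rotated])
  moreover have "int (conductor G) \<le> int (e_s G) * int (delta G)"
    using assms by (metis of_nat_le_iff of_nat_mult)
  ultimately show ?thesis
    unfolding Eliahou_def nu_num_def by linarith
qed

theorem corollary5p4:
  fixes \<Gamma> :: "nat set" and m k :: nat
  assumes "numerical_semigroup \<Gamma>"
    and "\<Gamma> \<noteq> UNIV"
    and "m = multiplicity \<Gamma>"
    and "k = concentration \<Gamma>"
  shows "(k \<ge> 2 \<and> e_s \<Gamma> \<ge> k + 1 \<and> int (delta \<Gamma>) \<ge> int m - int k \<and> conductor \<Gamma> > 2 * m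
            \<longrightarrow> Eliahou \<Gamma> \<ge> 0) \<and>
         (highly_dense \<Gamma> \<and> e_s \<Gamma> \<ge> k + 1 \<and> int (delta \<Gamma>) \<ge> int m - int k
            \<longrightarrow> Eliahou \<Gamma> \<ge> 0)"
proof -
  have G: "add_submonoid \<Gamma>" and gcd: "Gcd \<Gamma> = 1"
    using assms(1) by (auto simp: numerical_semigroup_def)
  have "\<not> \<Gamma> \<subseteq> {0}"
    using gcd by (metis Gcd_0_iff zero_neq_one)
  then obtain x where x: "x \<in> \<Gamma>" "x \<noteq> 0" by auto
  have "Eliahou \<Gamma> \<ge> 0" if e: "k + 1 \<le> e_s \<Gamma>" and d: "int m - int k \<le> int (delta \<Gamma>)"
  proof (rule Eliahou_nonneg_if_conductor_le)
    have "conductor \<Gamma> + k \<le> m + k * delta \<Gamma>"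
      using conductor_le_concentration[OF G x] assms(3,4) by simp
    with d have "conductor \<Gamma> \<le> (k + 1) * delta \<Gamma>"
      by simp
    also have "\<dots> \<le> e_s \<Gamma> * delta \<Gamma>"
      using e by (rule mult_right_mono) simp
    finally show "conductor \<Gamma> \<le> e_s \<Gamma> * delta \<Gamma>" .
  qed
  then show ?thesis by blast
qed

end
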